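(* Let $\mathcal{H}$ be a complex separable Hilbert space, $W$ a bounded positive semi-definite operator on $\mathcal{H}$, $A\subseteq\mathcal{H}\times\mathcal{H}$ a linear relation, $b\in\operatorname{dom}P_{W,\operatorname{ran}A}$, and let $x_0$ be a $W$-least squares solution of the inclusion $b\in Ax$. Then the set of $W$-least squares solutions of the inclusion $b\in Ax$ is $$x_0+A^{-1}(\operatorname{mul}P_{W,\operatorname{ran}A})=x_0+A^{-1}(\ker W).$$
   Context: A linear relation in $\mathcal{H}$ is a linear subspace $T$ of $\mathcal{H}\times\mathcal{H}$. $\operatorname{dom}T$, $\operatorname{ran}T$ are the domain and range, $\operatorname{mul}T=\{y:(0,y)\in T\}$, $T^{-1}=\{(y,x):(x,y)\in T\}$; for a subspace $\mathcal{L}$, $T(\mathcal{L})=\{y:(x,y)\in T\text{ for some }x\in\mathcal{L}\}$, and $Tx=T(\{x\})$. $\|x\|_W:=\|W^{1/2}x\|$. A vector $x_0\in\mathcal{H}$ is a $W$-least squares solution of the inclusion $b\in Ax$ if $x_0\in\operatorname{dom}A$ and there exists $z\in Ax_0$ with $\|z-b\|_W=\min_{y\in\operatorname{ran}A}\|y-b\|_W$. For a (not necessarily closed) subspace $\mathcal{S}$, $P_{W,\mathcal{S}}:=\{(s+n,s):s\in\mathcal{S},\ n\in(W\mathcal{S})^\perp\}$, where $(W\mathcal{S})^\perp=\{x:\langle Wx,s\rangle=0\ \forall s\in\mathcal{S}\}$. *)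

theory Defs
  imports "HOL-Analysis.Analysis"
begin

section \<open>Complex Hilbert spaces\<close>

class complex_vector = real_vector +
  fixes scaleC :: "complex \<Rightarrow> 'a \<Rightarrow> 'a"  (infixr \<open>*\<^sub>C\<close> 75)
  assumes scaleC_add_right: "c *\<^sub>C (x + y) = c *\<^sub>C x + c *\<^sub>C y"
    and scaleC_add_left: "(c + d) *\<^sub>C x = c *\<^sub>C x + d *\<^sub>C x"
    and scaleC_scaleC: "c *\<^sub>C (d *\<^sub>C x) = (c * d) *\<^sub>C x"
    and scaleC_one: "1 *\<^sub>C x = x"
    and scaleC_of_real: "complex_of_real r *\<^sub>C x = r *\<^sub>R x"

global_interpretation complex_vector: vector_space "scaleC :: complex \<Rightarrow> 'a \<Rightarrow> 'a::complex_vector"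
  by unfold_locales (fact scaleC_add_right scaleC_add_left scaleC_scaleC scaleC_one)+

text \<open>The inner product is linear in the first argument. Its real part is the inner product
  of the underlying real space, so the norm is \<open>norm x = sqrt (Re (cinner x x))\<close>, and the metric
  and the topology are those of the class \<^class>\<open>real_inner\<close>.\<close>

class complex_inner = complex_vector + real_inner +
  fixes cinner :: "'a \<Rightarrow> 'a \<Rightarrow> complex"
  assumes cinner_add_left: "cinner (x + y) z = cinner x z + cinner y z"
    and cinner_scaleC_left: "cinner (c *\<^sub>C x) y = c * cinner x y"
    and cinner_commute: "cinner x y = cnj (cinner y x)"
    and Re_cinner: "Re (cinner x y) = inner x y"

class complex_hilbert_space = complex_inner + complete_space

instantiation prod :: (complex_vector, complex_vector) complex_vector
begin

definition scaleC_prod_def: "c *\<^sub>C p = (c *\<^sub>C fst p, c *\<^sub>C snd p)"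

instance
  by standard
    (auto simp: scaleC_prod_def scaleC_add_right scaleC_add_left scaleC_scaleC scaleC_one
       scaleC_of_real scaleR_prod_def prod_eq_iff)

end

instantiation complex :: complex_hilbert_space
begin

definition scaleC_complex_def: "c *\<^sub>C z = c * (z::complex)"

definition cinner_complex_def: "cinner w z = w * cnj z"

instance
  by standard
    (auto simp: scaleC_complex_def cinner_complex_def inner_complex_def scaleR_conv_of_real
       algebra_simps)

end


section \<open>Positive operators, square roots and W-seminorms\<close>

definition bounded_clinear :: "('a::complex_inner \<Rightarrow> 'a) \<Rightarrow> bool" where
  "bounded_clinear W \<longleftrightarrow> Vector_Spaces.linear (*\<^sub>C) (*\<^sub>C) W \<and> bounded_linear W"

definition positive_op :: "('a::complex_inner \<Rightarrow> 'a) \<Rightarrow> bool" where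
  "positive_op W \<longleftrightarrow> bounded_clinear W \<and> (\<forall>x. cinner (W x) x \<in> \<real>\<^sub>\<ge>\<^sub>0)"

text \<open>The positive square root, which exists uniquely if \<open>W\<close> is a positive bounded operator
  on a Hilbert space.\<close>

definition sqrt_op :: "('a::complex_inner \<Rightarrow> 'a) \<Rightarrow> 'a \<Rightarrow> 'a" where
  "sqrt_op W = (THE R. positive_op R \<and> R \<circ> R = W)"

definition W_norm :: "('a::complex_inner \<Rightarrow> 'a) \<Rightarrow> 'a \<Rightarrow> real" where
  "W_norm W x = norm (sqrt_op W x)"


section \<open>Linear relations\<close>

text \<open>Domain, range, inverse and image of a linear relation are \<^const>\<open>Domain\<close>, \<^const>\<open>Range\<close>,
  \<^const>\<open>converse\<close> and \<^const>\<open>Image\<close>.\<close>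

definition linear_relation :: "('a::complex_vector \<times> 'a) set \<Rightarrow> bool" where
  "linear_relation T \<longleftrightarrow> complex_vector.subspace T"

definition mul :: "('a::complex_vector \<times> 'a) set \<Rightarrow> 'a set" where
  "mul T = {y. (0, y) \<in> T}"

definition ker_op :: "('a::complex_vector \<Rightarrow> 'a) \<Rightarrow> 'a set" where
  "ker_op W = {x. W x = 0}"

text \<open>For positive (hence self-adjoint) \<open>W\<close> this is the orthogonal complement of \<open>W ` S\<close>.\<close>

definition W_orthogonal :: "('a::complex_inner \<Rightarrow> 'a) \<Rightarrow> 'a set \<Rightarrow> 'a set" where
  "W_orthogonal W S = {x. \<forall>s\<in>S. cinner (W x) s = 0}"

definition W_projection :: "('a::complex_inner \<Rightarrow> 'a) \<Rightarrow> 'a set \<Rightarrow> ('a \<times> 'a) set" where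
  "W_projection W S = {(s + n, s) | s n. s \<in> S \<and> n \<in> W_orthogonal W S}"

definition W_least_squares_solution ::
  "('a::complex_inner \<Rightarrow> 'a) \<Rightarrow> ('a \<times> 'a) set \<Rightarrow> 'a \<Rightarrow> 'a \<Rightarrow> bool" where
  "W_least_squares_solution W A b x \<longleftrightarrow>
     x \<in> Domain A \<and>
     (\<exists>z \<in> A `` {x}. is_arg_min (\<lambda>y. W_norm W (y - b)) (\<lambda>y. y \<in> Range A) z)"

end

theory Submission
  imports Defs
begin

text \<open>The positive square root of \<open>W\<close> is \<open>R = \<surd>c \<cdot> (I - Y)\<close>, where \<open>c\<close> bounds \<open>W\<close> and \<open>Y\<close> is the
  limit of the iteration \<open>Y \<mapsto> (B + Y\<^sup>2) / 2\<close> for the contraction \<open>B = I - W / c\<close>. The increments of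
  the iteration are dominated by those of the scalar iteration \<open>t \<mapsto> (1 + t\<^sup>2) / 2\<close>, which increases
  and is bounded by \<open>1\<close>. A positive square root \<open>Q\<close> of \<open>W\<close> commutes with \<open>W\<close>, hence with \<open>R\<close>,
  so \<open>(Q + R) (Q - R) = 0\<close>, which forces \<open>Q = R\<close>. Consequently the square of the W-norm is
  \<open>\<langle>W x, x\<rangle>\<close>. If \<open>b = s + n\<close> with \<open>s \<in> ran A\<close> and \<open>n\<close> W-orthogonal to \<open>ran A\<close>, then by Pythagoras
  \<open>y \<in> ran A\<close> minimises the W-distance to \<open>b\<close> if and only if \<open>W y = W s\<close>.\<close>

section \<open>Complex-linear operators and positivity\<close>

lemma clinear_iff:
  "Vector_Spaces.linear (*\<^sub>C) (*\<^sub>C) (f :: 'a::complex_vector \<Rightarrow> 'a) \<longleftrightarrow>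
     (\<forall>x y. f (x + y) = f x + f y) \<and> (\<forall>c x. f (c *\<^sub>C x) = c *\<^sub>C f x)"
  unfolding Vector_Spaces.linear_iff
  using complex_vector.vector_space_axioms by blast

lemma clinear_scaleR:
  assumes "Vector_Spaces.linear (*\<^sub>C) (*\<^sub>C) (f :: 'a::complex_vector \<Rightarrow> 'a)"
  shows "f (r *\<^sub>R x) = r *\<^sub>R f x"
  using assms by (simp add: clinear_iff flip: scaleC_of_real)

lemma clinear_diff:
  assumes "Vector_Spaces.linear (*\<^sub>C) (*\<^sub>C) (f :: 'a::complex_vector \<Rightarrow> 'a)"
  shows "f (x - y) = f x - f y"
  using assms clinear_scaleR[OF assms, of "-1" y]
  by (metis clinear_iff diff_conv_add_uminus scaleR_minus1_left)

lemma scaleC_scaleR_commute: "c *\<^sub>C (r *\<^sub>R x) = r *\<^sub>R (c *\<^sub>C (x :: 'a::complex_vector))"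
  by (metis mult.commute scaleC_of_real scaleC_scaleC)

lemma scaleC_diff_right: "c *\<^sub>C (x - y) = c *\<^sub>C x - c *\<^sub>C (y :: 'a::complex_vector)"
  by (metis add_diff_cancel_right' diff_add_cancel scaleC_add_right)

lemma cinner_add_right: "cinner x (y + z) = cinner x y + cinner x (z :: 'a::complex_inner)"
  by (metis cinner_add_left cinner_commute complex_cnj_add)

lemma cinner_scaleC_right: "cinner x (c *\<^sub>C y) = cnj c * cinner x (y :: 'a::complex_inner)"
  by (metis cinner_commute cinner_scaleC_left complex_cnj_mult)

lemma cinner_zero_left: "cinner 0 (x :: 'a::complex_inner) = 0"
  using cinner_add_left[of 0 0 x] by simp

lemma bounded_clinearI:
  fixes f :: "'a::complex_inner \<Rightarrow> 'a"
  assumes "Vector_Spaces.linear (*\<^sub>C) (*\<^sub>C) f" "\<And>x. norm (f x) \<le> K * norm x"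
  shows "bounded_clinear f"
proof -
  have "bounded_linear f"
  proof (rule bounded_linear_intro)
    show "f (x + y) = f x + f y" for x y
      using assms(1) by (simp add: clinear_iff)
    show "f (r *\<^sub>R x) = r *\<^sub>R f x" for r x
      using assms(1) by (rule clinear_scaleR)
    show "norm (f x) \<le> norm x * K" for x
      using assms(2)[of x] by (simp add: mult.commute)
  qed
  then show ?thesis
    using assms(1) by (simp add: bounded_clinear_def)
qed

section \<open>Positive operators and their quadratic forms\<close>

lemma positive_op_linear:
  "positive_op W \<Longrightarrow> Vector_Spaces.linear (*\<^sub>C) (*\<^sub>C) W"
  "positive_op W \<Longrightarrow> bounded_linear W"
  by (simp_all add: positive_op_def bounded_clinear_def)

lemma positive_op_nonneg: "positive_op W \<Longrightarrow> 0 \<le> inner (W x) x"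
  unfolding positive_op_def Re_cinner[symmetric] by (auto simp: complex_nonneg_Reals_iff)

text \<open>Complex scalars are essential: the quadratic form is real at
  \<open>x + \<i> *\<^sub>C y\<close>, and the imaginary part of its cross terms is the defect of
  symmetry.\<close>

lemma positive_op_symmetric:
  assumes "positive_op W"
  shows "inner (W x) y = inner x (W y)"
proof -
  have real: "Im (cinner (W z) z) = 0" for z
    using assms by (auto simp: positive_op_def complex_nonneg_Reals_iff)
  have "Im (cinner (W (x + \<i> *\<^sub>C y)) (x + \<i> *\<^sub>C y)) =
      Im (cinner (W x) x) + Im (cinner (W y) y) - Re (cinner (W x) y) + Re (cinner (W y) x)"
    using positive_op_linear(1)[OF assms]
    by (simp add: clinear_iff cinner_add_left cinner_add_right cinner_scaleC_left
        cinner_scaleC_right)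
  then show ?thesis
    using real by (simp add: Re_cinner inner_commute)
qed

text \<open>Makes the real inner product suffice for positivity: symmetry at the pair
  \<open>\<i> *\<^sub>C x\<close>, \<open>x\<close> removes the imaginary part of the form.\<close>

lemma positive_opI:
  fixes W :: "'a::complex_inner \<Rightarrow> 'a"
  assumes "bounded_clinear W" "\<And>x y. inner (W x) y = inner x (W y)"
    and "\<And>x. 0 \<le> inner (W x) x"
  shows "positive_op W"
proof -
  have "Im (cinner (W x) x) = 0" for x
  proof -
    have "inner (W (\<i> *\<^sub>C x)) x = inner (\<i> *\<^sub>C x) (W x)"
      by (rule assms(2))
    then have "- Im (cinner (W x) x) = - Im (cinner x (W x))"
      using assms(1)
      by (simp add: bounded_clinear_def clinear_iff cinner_scaleC_left flip: Re_cinner)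
    moreover have "Im (cinner x (W x)) = - Im (cinner (W x) x)"
      by (subst cinner_commute) simp
    ultimately show ?thesis
      by simp
  qed
  then show ?thesis
    using assms(1,3) by (auto simp: positive_op_def complex_nonneg_Reals_iff Re_cinner)
qed

text \<open>Positivity is tested at \<open>c *\<^sub>R x - W x\<close>; bounding the term quadratic
  in \<open>W x\<close> by \<open>c\<close> times its squared norm leaves \<open>c\<close> times the
  claimed difference.\<close>

lemma positive_op_norm_sq_le:
  assumes "positive_op W" "\<And>x. norm (W x) \<le> c * norm x" "c > 0"
  shows "(norm (W x))\<^sup>2 \<le> c * inner (W x) x"
proof -
  note lin = positive_op_linear(1)[OF assms(1)]
  let ?u = "W x"
  let ?y = "c *\<^sub>R x - ?u"
  have "0 \<le> inner (W ?y) ?y"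
    by (rule positive_op_nonneg[OF assms(1)])
  also have "inner (W ?y) ?y = c\<^sup>2 * inner ?u x - c * (inner ?u ?u + inner (W ?u) x) + inner (W ?u) ?u"
    by (simp add: clinear_diff[OF lin] clinear_scaleR[OF lin] inner_diff_left inner_diff_right
        power2_eq_square algebra_simps)
  also have "inner (W ?u) x = inner ?u ?u"
    by (rule positive_op_symmetric[OF assms(1)])
  also have "inner (W ?u) ?u \<le> c * norm ?u * norm ?u"
    by (meson assms(2) mult_right_mono norm_cauchy_schwarz norm_ge_zero order_trans)
  finally have "0 \<le> c * (c * inner ?u x - (norm ?u)\<^sup>2)"
    by (simp add: power2_eq_square algebra_simps flip: power2_norm_eq_inner)
  then show ?thesis
    using assms(3) by (simp add: zero_le_mult_iff)
qed

lemma positive_op_bound: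
  assumes "positive_op W"
  obtains c where "c > 0" "\<And>x. norm (W x) \<le> c * norm x"
  using bounded_linear.pos_bounded[OF positive_op_linear(2)[OF assms]]
  by (metis mult.commute)

text \<open>The preceding bound turns a zero of the quadratic form into a kernel vector.\<close>

lemma positive_op_eq_0_iff:
  assumes "positive_op W"
  shows "inner (W x) x = 0 \<longleftrightarrow> W x = 0"
proof
  obtain c where "c > 0" "\<And>x. norm (W x) \<le> c * norm x"
    using positive_op_bound[OF assms] by blast
  moreover assume "inner (W x) x = 0"
  ultimately have "(norm (W x))\<^sup>2 \<le> 0"
    using positive_op_norm_sq_le[OF assms, of c x] by simp
  then show "W x = 0"
    by simp
qed simp

section \<open>The positive square root\<close>

text \<open>The equation (I - Y)^2 = I - B, rewritten as the fixed point problem Y = (B + Y^2)/2 and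
  iterated from 0.\<close>

primrec sqrt_iter :: "('a::real_vector \<Rightarrow> 'a) \<Rightarrow> nat \<Rightarrow> 'a \<Rightarrow> 'a" where
  "sqrt_iter B 0 = (\<lambda>x. 0)"
| "sqrt_iter B (Suc n) = (\<lambda>x. (1/2) *\<^sub>R (B x + sqrt_iter B n (sqrt_iter B n x)))"

text \<open>The scalar case B = 1, the extremal one among contractions.\<close>

primrec sqrt_bound :: "nat \<Rightarrow> real" where
  "sqrt_bound 0 = 0"
| "sqrt_bound (Suc n) = (1 + (sqrt_bound n)\<^sup>2) / 2"

lemma sqrt_bound_range: "0 \<le> sqrt_bound n \<and> sqrt_bound n \<le> 1"
  by (induction n) (auto simp: power_le_one)

text \<open>The increment is (t - 1)^2 / 2 with t = \<open>sqrt_bound n\<close>.\<close>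

lemma sqrt_bound_Suc_ge: "sqrt_bound n \<le> sqrt_bound (Suc n)"
  using zero_le_power2[of "sqrt_bound n - 1"] by (simp add: power2_diff)

lemma sqrt_iter_clinear:
  assumes "Vector_Spaces.linear (*\<^sub>C) (*\<^sub>C) (B :: 'a::complex_vector \<Rightarrow> 'a)"
  shows "Vector_Spaces.linear (*\<^sub>C) (*\<^sub>C) (sqrt_iter B n)"
proof (induction n)
  case 0
  then show ?case by (simp add: clinear_iff)
next
  case (Suc n)
  then show ?case using assms
    by (simp add: clinear_iff scaleR_add_right scaleC_add_right scaleC_scaleR_commute algebra_simps)
qed

text \<open>Iterates arise from \<open>B\<close> by sums, real multiples and composition. This
  serves both to make iterates commute with each other and to place the root in the bicommutant of
  \<open>W\<close>.\<close>

lemma sqrt_iter_commute: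
  assumes "linear C" "\<And>x. C (B x) = B (C x)"
  shows "C (sqrt_iter B n x) = sqrt_iter B n (C x)"
  by (induction n arbitrary: x)
    (simp_all add: assms linear_0 linear_add linear_cmul)

lemma sqrt_iter_symmetric:
  assumes "\<And>x y. inner (B x) y = inner x (B y)"
  shows "inner (sqrt_iter B n x) y = inner x (sqrt_iter B n y)"
  by (induction n arbitrary: x y) (simp_all add: inner_add_left inner_add_right assms)

lemma sqrt_iter_norm_le:
  assumes "\<And>x. norm (B x) \<le> norm x"
  shows "norm (sqrt_iter B n x) \<le> sqrt_bound n * norm x"
proof (induction n arbitrary: x)
  case (Suc n)
  have "norm (sqrt_iter B n (sqrt_iter B n x)) \<le> sqrt_bound n * (sqrt_bound n * norm x)"
    by (meson Suc mult_left_mono order_trans sqrt_bound_range)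
  then have "norm (B x + sqrt_iter B n (sqrt_iter B n x)) \<le> norm x + (sqrt_bound n)\<^sup>2 * norm x"
    using norm_triangle_ineq[of "B x" "sqrt_iter B n (sqrt_iter B n x)"] assms[of x]
    by (simp add: power2_eq_square mult.assoc)
  \<comment> \<open>The factor 1/2 must not be distributed over the sum, or it could not be pulled
    out of the norm.\<close>
  moreover have "norm (sqrt_iter B (Suc n) x) = norm (B x + sqrt_iter B n (sqrt_iter B n x)) / 2"
    by (simp del: scaleR_add_right)
  ultimately show ?case
    by (simp add: algebra_simps add_divide_distrib)
qed simp

text \<open>Gives access to the comparison test for series of vectors.\<close>

instance complex_hilbert_space \<subseteq> banach ..

section \<open>Convergence of the iteration for a contraction\<close>

context
  fixes B :: "'a::complex_hilbert_space \<Rightarrow> 'a"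
  assumes B_linear: "Vector_Spaces.linear (*\<^sub>C) (*\<^sub>C) B"
    and B_norm: "\<And>x. norm (B x) \<le> norm x"
begin

lemma linear_sqrt_iter: "linear (sqrt_iter B n)"
proof (rule linearI)
  note lin = sqrt_iter_clinear[OF B_linear, of n]
  show "sqrt_iter B n (x + y) = sqrt_iter B n x + sqrt_iter B n y" for x y
    using lin by (simp add: clinear_iff)
  show "sqrt_iter B n (r *\<^sub>R x) = r *\<^sub>R sqrt_iter B n x" for r x
    using lin by (rule clinear_scaleR)
qed

lemma sqrt_iter_commute_sqrt_iter:
  "sqrt_iter B m (sqrt_iter B n x) = sqrt_iter B n (sqrt_iter B m x)"
proof -
  have "linear B"
    using B_linear by (intro linearI) (auto simp: clinear_iff clinear_scaleR)
  then show ?thesis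
    \<comment> \<open>Used twice: first an iterate commutes with \<open>B\<close>, hence then with
      every other iterate.\<close>
    by (intro sqrt_iter_commute linear_sqrt_iter) (simp add: sqrt_iter_commute)
qed

text \<open>As iterates commute, Y^2 - Z^2 = (Y + Z)(Y - Z), just as for scalars, so the increments
  obey the scalar recursion up to inequality.\<close>

lemma sqrt_iter_diff_le:
  "norm (sqrt_iter B (Suc n) x - sqrt_iter B n x) \<le> (sqrt_bound (Suc n) - sqrt_bound n) * norm x"
proof (induction n arbitrary: x)
  case 0
  then show ?case using B_norm[of x] by simp
next
  case (Suc n)
  let ?Y = "sqrt_iter B (Suc n)" and ?Z = "sqrt_iter B n"
  let ?s = "sqrt_bound (Suc n)" and ?t = "sqrt_bound n"
  let ?d = "?Y x - ?Z x"
  have "?Y (?Y x) - ?Z (?Z x) = ?Y ?d + ?Z ?d"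
    using sqrt_iter_commute_sqrt_iter[of "Suc n" n x]
    by (simp only: linear_diff[OF linear_sqrt_iter]) simp
  then have "sqrt_iter B (Suc (Suc n)) x - ?Y x = (1/2) *\<^sub>R (?Y ?d + ?Z ?d)"
    \<comment> \<open>Besides the top iterate only the subtracted one is unfolded;
      \<open>B x\<close> then cancels and the difference of squares remains.\<close>
    by (simp only: sqrt_iter.simps(2)[of B "Suc n"])
      (subst (3) sqrt_iter.simps(2), simp only: scaleR_diff_right[symmetric] add_diff_cancel_left)
  then have "norm (sqrt_iter B (Suc (Suc n)) x - ?Y x) = norm (?Y ?d + ?Z ?d) / 2"
    by simp
  also have "norm (?Y ?d + ?Z ?d) \<le> ?s * norm ?d + ?t * norm ?d"
    by (rule norm_triangle_le, rule add_mono; rule sqrt_iter_norm_le[OF B_norm])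
  also have "\<dots> = (?s + ?t) * norm ?d"
    by (simp only: distrib_right)
  also have "\<dots> \<le> (?s + ?t) * ((?s - ?t) * norm x)"
    using sqrt_bound_range[of n] sqrt_bound_range[of "Suc n"]
    by (intro mult_left_mono Suc.IH) linarith
  also have "\<dots> / 2 = (sqrt_bound (Suc (Suc n)) - ?s) * norm x"
    by (simp only: sqrt_bound.simps(2)[of "Suc n"]) (simp add: power2_eq_square field_simps)
  finally show ?case
    by simp
qed

text \<open>The scalar increments telescope to a convergent series that dominates; the vector
  partial sums are the iterates because the iteration starts at 0.\<close>

lemma sqrt_iter_convergent: "convergent (\<lambda>n. sqrt_iter B n x)"
proof -
  have "convergent sqrt_bound"
  proof (rule Bseq_mono_convergent)
    show "Bseq sqrt_bound"
      using sqrt_bound_range by (intro BseqI'[of _ 1]) simp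
    show "\<forall>m n. m \<le> n \<longrightarrow> sqrt_bound m \<le> sqrt_bound n"
      using lift_Suc_mono_le sqrt_bound_Suc_ge by blast
  qed
  then obtain l where "sqrt_bound \<longlonglongrightarrow> l"
    by (auto simp: convergent_def)
  then have "summable (\<lambda>n. (sqrt_bound (Suc n) - sqrt_bound n) * norm x)"
    by (intro summable_mult2) (rule telescope_summable)
  then have "summable (\<lambda>n. sqrt_iter B (Suc n) x - sqrt_iter B n x)"
    by (rule summable_comparison_test') (rule sqrt_iter_diff_le)
  then have "convergent (\<lambda>n. \<Sum>k<n. sqrt_iter B (Suc k) x - sqrt_iter B k x)"
    by (simp only: summable_iff_convergent)
  then show ?thesis
    by (simp only: sum_lessThan_telescope[where f = "\<lambda>n. sqrt_iter B n x"] sqrt_iter.simps(1)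
        diff_zero)
qed

lemma sqrt_iter_limit:
  obtains Y where
    "Vector_Spaces.linear (*\<^sub>C) (*\<^sub>C) Y"
    "\<And>x. norm (Y x) \<le> norm x"
    "\<And>x. 2 *\<^sub>R Y x = B x + Y (Y x)"
    "\<And>x. (\<lambda>n. sqrt_iter B n x) \<longlonglongrightarrow> Y x"
proof -
  define Y where "Y x = lim (\<lambda>n. sqrt_iter B n x)" for x
  have lim: "(\<lambda>n. sqrt_iter B n x) \<longlonglongrightarrow> Y x" for x
    using sqrt_iter_convergent[of x] by (simp add: Y_def convergent_LIMSEQ_iff)
  have norm_iter: "norm (sqrt_iter B n x) \<le> norm x" for n x
    using sqrt_iter_norm_le[OF B_norm, of n x] sqrt_bound_range[of n]
    by (meson mult_left_le_one_le norm_ge_zero order_trans)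
  have norm_Y: "norm (Y x) \<le> norm x" for x
    using LIMSEQ_le_const2[OF tendsto_norm[OF lim]] norm_iter by blast
  have "Y (x + y) = Y x + Y y" for x y
  proof (rule LIMSEQ_unique[OF lim])
    show "(\<lambda>n. sqrt_iter B n (x + y)) \<longlonglongrightarrow> Y x + Y y"
      using tendsto_add[OF lim lim] by (simp add: linear_add[OF linear_sqrt_iter])
  qed
  moreover have "Y (c *\<^sub>C x) = c *\<^sub>C Y x" for c x
  proof (rule LIMSEQ_unique[OF lim])
    \<comment> \<open>Continuity of multiplication by \<open>c\<close> carries complex homogeneity
      to the limit.\<close>
    have "norm (c *\<^sub>C z) = cmod c * norm z" for z :: 'a
    proof -
      have "(norm (c *\<^sub>C z))\<^sup>2 = Re (c * cnj c * cinner z z)"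
        by (simp add: power2_norm_eq_inner cinner_scaleC_left cinner_scaleC_right algebra_simps
            flip: Re_cinner)
      also have "\<dots> = (cmod c * norm z)\<^sup>2"
        unfolding complex_norm_square[symmetric]
        by (simp add: Re_cinner power_mult_distrib del: of_real_power flip: power2_norm_eq_inner)
      finally show ?thesis
        by (simp add: power2_eq_iff_nonneg)
    qed
    then have "bounded_linear ((*\<^sub>C) c :: 'a \<Rightarrow> 'a)"
      by (intro bounded_linear_intro[where K = "cmod c"])
        (simp_all add: scaleC_add_right scaleC_scaleR_commute)
    from bounded_linear.tendsto[OF this lim]
    show "(\<lambda>n. sqrt_iter B n (c *\<^sub>C x)) \<longlonglongrightarrow> c *\<^sub>C Y x"
      using sqrt_iter_clinear[OF B_linear] by (simp add: clinear_iff)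
  qed
  ultimately have Y_linear: "Vector_Spaces.linear (*\<^sub>C) (*\<^sub>C) Y"
    by (simp add: clinear_iff)
  have "2 *\<^sub>R Y x = B x + Y (Y x)" for x
  proof -
    \<comment> \<open>Operator and argument both vary with \<open>n\<close>; the uniform bound on
      the iterates disposes of the varying argument, leaving the pointwise limit at
      \<open>Y x\<close>.\<close>
    have "(\<lambda>n. sqrt_iter B n (sqrt_iter B n x - Y x)) \<longlonglongrightarrow> 0"
    proof (rule Lim_null_comparison)
      show "\<forall>\<^sub>F n in sequentially.
          norm (sqrt_iter B n (sqrt_iter B n x - Y x)) \<le> norm (sqrt_iter B n x - Y x)"
        using norm_iter by simp
      show "(\<lambda>n. norm (sqrt_iter B n x - Y x)) \<longlonglongrightarrow> 0"
        using lim by (simp add: tendsto_norm_zero_iff LIM_zero_iff)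
    qed
    from tendsto_add[OF this lim[of "Y x"]]
    have "(\<lambda>n. sqrt_iter B n (sqrt_iter B n x)) \<longlonglongrightarrow> Y (Y x)"
      by (simp add: linear_diff[OF linear_sqrt_iter])
    then have "(\<lambda>n. 2 *\<^sub>R sqrt_iter B (Suc n) x) \<longlonglongrightarrow> B x + Y (Y x)"
      by (simp add: tendsto_add)
    moreover have "(\<lambda>n. 2 *\<^sub>R sqrt_iter B (Suc n) x) \<longlonglongrightarrow> 2 *\<^sub>R Y x"
      by (intro tendsto_scaleR tendsto_const LIMSEQ_Suc lim)
    ultimately show ?thesis
      using LIMSEQ_unique by blast
  qed
  with Y_linear norm_Y lim show ?thesis
    using that by blast
qed

end

section \<open>Existence of the root and its commutation property\<close>

lemma positive_op_sqrt_exists: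
  fixes W :: "'a::complex_hilbert_space \<Rightarrow> 'a"
  assumes "positive_op W"
  obtains R where "positive_op R" "R \<circ> R = W"
    "\<And>C x. bounded_linear C \<Longrightarrow> (\<And>x. C (W x) = W (C x)) \<Longrightarrow> C (R x) = R (C x)"
proof -
  note W_linear = positive_op_linear(1)[OF assms]
  obtain c where c: "c > 0" "\<And>x. norm (W x) \<le> c * norm x"
    using positive_op_bound[OF assms] by blast
  define B where "B x = x - (1/c) *\<^sub>R W x" for x
  have B_linear: "Vector_Spaces.linear (*\<^sub>C) (*\<^sub>C) B"
    using W_linear by (simp add: B_def clinear_iff scaleR_add_right scaleC_diff_right
        scaleC_scaleR_commute)
  have B_norm: "norm (B x) \<le> norm x" for x
  proof -
    have "(norm (B x))\<^sup>2 = (norm x)\<^sup>2 - 2 * (inner (W x) x / c) + (norm (W x))\<^sup>2 / c\<^sup>2"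
      unfolding B_def power2_norm_eq_inner using c(1)
      by (simp add: inner_diff_left inner_diff_right inner_commute power2_eq_square field_simps)
    \<comment> \<open>The quadratic term absorbs only half of the subtracted cross term.\<close>
    also have "(norm (W x))\<^sup>2 / c\<^sup>2 \<le> inner (W x) x / c"
      using positive_op_norm_sq_le[OF assms c(2,1), of x] c(1)
      by (simp add: power2_eq_square field_simps)
    finally have "(norm (B x))\<^sup>2 \<le> (norm x)\<^sup>2"
      using positive_op_nonneg[OF assms, of x] c(1) by (smt (verit) divide_nonneg_pos)
    then show ?thesis
      by simp
  qed
  obtain Y where Y: "Vector_Spaces.linear (*\<^sub>C) (*\<^sub>C) Y" "\<And>x. norm (Y x) \<le> norm x"
    "\<And>x. 2 *\<^sub>R Y x = B x + Y (Y x)" and lim: "\<And>x. (\<lambda>n. sqrt_iter B n x) \<longlonglongrightarrow> Y x"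
    using sqrt_iter_limit[OF B_linear B_norm] by blast
  have Y_symmetric: "inner (Y x) y = inner x (Y y)" for x y
  proof (rule LIMSEQ_unique)
    have "inner (B x) y = inner x (B y)" for x y
      by (simp add: B_def inner_diff_left inner_diff_right positive_op_symmetric[OF assms])
    then show "(\<lambda>n. inner (sqrt_iter B n x) y) \<longlonglongrightarrow> inner x (Y y)"
      by (subst sqrt_iter_symmetric) (auto intro!: tendsto_inner lim)
    show "(\<lambda>n. inner (sqrt_iter B n x) y) \<longlonglongrightarrow> inner (Y x) y"
      by (intro tendsto_inner lim tendsto_const)
  qed
  \<comment> \<open>Commutation with each iterate survives the limit since \<open>C\<close> is
    continuous.\<close>
  have Y_commute: "C (Y x) = Y (C x)"
    if C: "bounded_linear C" "\<And>x. C (W x) = W (C x)" for C x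
  proof (rule LIMSEQ_unique)
    have "linear C"
      using C(1) by (rule bounded_linear.linear)
    moreover from this have "C (B z) = B (C z)" for z
      by (simp add: B_def linear_diff linear_cmul C(2))
    ultimately have "C (sqrt_iter B n x) = sqrt_iter B n (C x)" for n
      by (rule sqrt_iter_commute)
    with bounded_linear.tendsto[OF C(1) lim[of x]]
    show "(\<lambda>n. sqrt_iter B n (C x)) \<longlonglongrightarrow> C (Y x)"
      by simp
  qed (rule lim)
  define R where "R x = sqrt c *\<^sub>R (x - Y x)" for x
  have "positive_op R"
  proof (rule positive_opI)
    show "bounded_clinear R"
    proof (rule bounded_clinearI[where K = "sqrt c * 2"])
      show "Vector_Spaces.linear (*\<^sub>C) (*\<^sub>C) R"
        using Y(1) by (simp add: R_def clinear_iff scaleR_add_right scaleR_diff_right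
            scaleC_diff_right scaleC_scaleR_commute)
      show "norm (R x) \<le> sqrt c * 2 * norm x" for x
        using norm_triangle_ineq4[of x "Y x"] Y(2)[of x] c(1) by (simp add: R_def)
    qed
    show "inner (R x) y = inner x (R y)" for x y
      by (simp add: R_def inner_diff_left inner_diff_right Y_symmetric)
    show "0 \<le> inner (R x) x" for x
    proof -
      have "inner (Y x) x \<le> norm (Y x) * norm x"
        by (rule norm_cauchy_schwarz)
      also have "\<dots> \<le> norm x * norm x"
        by (intro mult_right_mono Y(2)) simp
      finally have "inner (Y x) x \<le> inner x x"
        by (simp add: power2_eq_square flip: power2_norm_eq_inner)
      then show ?thesis
        using c(1) by (simp add: R_def inner_diff_left)
    qed
  qed
  moreover have "R (R x) = W x" for x
  proof -
    \<comment> \<open>By the fixed point equation, (I - Y)^2 = I - B, which is W / c.\<close>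
    have "R (R x) = c *\<^sub>R (x - 2 *\<^sub>R Y x + Y (Y x))"
      using c(1) by (simp add: R_def clinear_scaleR[OF Y(1)] clinear_diff[OF Y(1)] scaleR_2
          algebra_simps flip: real_sqrt_mult)
    also have "\<dots> = c *\<^sub>R (x - B x)"
      by (simp add: Y(3))
    also have "\<dots> = W x"
      using c(1) by (simp add: B_def)
    finally show ?thesis .
  qed
  then have "R \<circ> R = W"
    by auto
  moreover have "C (R x) = R (C x)"
    if "bounded_linear C" "\<And>x. C (W x) = W (C x)" for C x
    using bounded_linear.linear[OF that(1)] Y_commute[OF that]
    by (simp add: R_def linear_cmul linear_diff)
  ultimately show ?thesis
    using that by blast
qed

lemma positive_op_sqrt_unique:
  assumes R: "positive_op R" and Q: "positive_op Q"
    and eq: "\<And>x. R (R x) = Q (Q x)" and comm: "\<And>x. Q (R x) = R (Q x)"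
  shows "Q = R"
proof
  fix x
  define y where "y = Q x - R x"
  have "Q y + R y = 0"
    by (simp add: y_def clinear_diff[OF positive_op_linear(1)[OF Q]]
        clinear_diff[OF positive_op_linear(1)[OF R]] eq comm)
  \<comment> \<open>A sum of two nonnegative forms vanishes, so each does.\<close>
  then have "inner (Q y) y + inner (R y) y = 0"
    by (metis inner_add_left inner_zero_left)
  then have "inner (Q y) y = 0" "inner (R y) y = 0"
    using positive_op_nonneg[OF Q, of y] positive_op_nonneg[OF R, of y] by linarith+
  then have "Q y = 0" "R y = 0"
    by (simp_all add: positive_op_eq_0_iff Q R)
  \<comment> \<open>Symmetry moves \<open>Q\<close> and \<open>R\<close> onto \<open>y\<close>,
    where both vanish.\<close>
  moreover have "inner y y = inner x (Q y) - inner x (R y)"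
    unfolding positive_op_symmetric[OF Q, symmetric] positive_op_symmetric[OF R, symmetric]
    by (simp add: y_def inner_diff_left)
  ultimately show "Q x = R x"
    by (simp add: y_def)
qed

text \<open>Existence and uniqueness together give the definite description its meaning.\<close>

lemma sqrt_op_positive:
  fixes W :: "'a::complex_hilbert_space \<Rightarrow> 'a"
  assumes "positive_op W"
  shows "positive_op (sqrt_op W)" "sqrt_op W (sqrt_op W x) = W x"
proof -
  obtain R where R: "positive_op R" "R \<circ> R = W"
    and comm: "\<And>C x. bounded_linear C \<Longrightarrow> (\<And>x. C (W x) = W (C x)) \<Longrightarrow> C (R x) = R (C x)"
    using positive_op_sqrt_exists[OF assms] by blast
  have "\<exists>!R. positive_op R \<and> R \<circ> R = W"
  proof (rule ex1I)
    show "positive_op R \<and> R \<circ> R = W"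
      using R by simp
    fix Q assume Q: "positive_op Q \<and> Q \<circ> Q = W"
    have "Q (R x) = R (Q x)" for x
      \<comment> \<open>\<open>Q\<close> commutes with its own square \<open>W\<close>, so
        \<open>comm\<close> applies.\<close>
      using Q by (intro comm) (auto simp: positive_op_linear(2))
    moreover have "R (R x) = Q (Q x)" for x
      using Q R(2) by (metis comp_apply)
    ultimately show "Q = R"
      using R(1) Q by (intro positive_op_sqrt_unique) auto
  qed
  from theI'[OF this, folded sqrt_op_def]
  show "positive_op (sqrt_op W)" "sqrt_op W (sqrt_op W x) = W x"
    by (auto simp: fun_eq_iff)
qed

section \<open>Weighted least squares\<close>

text \<open>Moving one root across the inner product replaces the root by \<open>W\<close>;
  comparisons of W-norms below rest on this form.\<close>

lemma W_norm_sq: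
  fixes W :: "'a::complex_hilbert_space \<Rightarrow> 'a"
  assumes "positive_op W"
  shows "(W_norm W x)\<^sup>2 = inner (W x) x"
  unfolding W_norm_def power2_norm_eq_inner
  by (metis assms positive_op_symmetric sqrt_op_positive)

lemma W_orthogonal_imp_inner_eq_0: "n \<in> W_orthogonal W S \<Longrightarrow> s \<in> S \<Longrightarrow> inner (W n) s = 0"
  unfolding W_orthogonal_def Re_cinner[symmetric] by simp

lemma W_norm_diff_orthogonal:
  fixes W :: "'a::complex_hilbert_space \<Rightarrow> 'a"
  assumes "positive_op W" "n \<in> W_orthogonal W S" "s \<in> S"
  shows "(W_norm W (s - n))\<^sup>2 = inner (W s) s + inner (W n) n"
proof -
  have "inner (W n) s = 0"
    using assms(2,3) by (rule W_orthogonal_imp_inner_eq_0)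
  moreover from this have "inner (W s) n = 0"
    using positive_op_symmetric[OF assms(1)] by (metis inner_commute)
  ultimately show ?thesis
    by (simp add: W_norm_sq[OF assms(1)] clinear_diff[OF positive_op_linear(1)[OF assms(1)]]
        inner_diff_left inner_diff_right)
qed

text \<open>A pair (0, s) means that -s is W-orthogonal to \<open>S\<close>, which contains s; so
  the form vanishes at s and s lies in the kernel.\<close>

lemma mul_W_projection:
  assumes "positive_op W" "complex_vector.subspace S"
  shows "mul (W_projection W S) = S \<inter> ker_op W"
proof (intro equalityI subsetI)
  fix s assume "s \<in> mul (W_projection W S)"
  then obtain n where s: "s \<in> S" and n: "n \<in> W_orthogonal W S" "s + n = 0"
    unfolding mul_def W_projection_def by force
  have "s = 0 - n"
    using n(2) by (simp add: add_eq_0_iff2)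
  then have "W s = - W n"
    \<comment> \<open>The instance at 0, 0 supplies \<open>W 0 = 0\<close>.\<close>
    using clinear_diff[OF positive_op_linear(1)[OF assms(1)], of 0 n]
      clinear_diff[OF positive_op_linear(1)[OF assms(1)], of 0 0] by simp
  with W_orthogonal_imp_inner_eq_0[OF n(1) s] have "inner (W s) s = 0"
    by simp
  with s show "s \<in> S \<inter> ker_op W"
    by (simp add: positive_op_eq_0_iff[OF assms(1)] ker_op_def)
next
  fix s assume s: "s \<in> S \<inter> ker_op W"
  then have "W (- s) = 0"
    using clinear_scaleR[OF positive_op_linear(1)[OF assms(1)], of "-1" s]
    by (simp add: ker_op_def)
  then have "- s \<in> W_orthogonal W S"
    by (simp add: W_orthogonal_def cinner_zero_left)
  with s show "s \<in> mul (W_projection W S)"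
    unfolding mul_def W_projection_def by force
qed

text \<open>On \<open>S\<close> the squared W-distances to \<open>s + n\<close> and to
  \<open>s\<close> differ by a constant, and \<open>s\<close> itself attains distance 0 to
  \<open>s\<close>.\<close>

lemma W_distance_minimal_iff:
  fixes W :: "'a::complex_hilbert_space \<Rightarrow> 'a"
  assumes "positive_op W" "complex_vector.subspace S" "s \<in> S" "n \<in> W_orthogonal W S"
  shows "is_arg_min (\<lambda>y. W_norm W (y - (s + n))) (\<lambda>y. y \<in> S) z \<longleftrightarrow> z \<in> S \<and> W z = W s"
proof -
  note W_linear = positive_op_linear(1)[OF assms(1)]
  have dist: "(W_norm W (y - (s + n)))\<^sup>2 = inner (W (y - s)) (y - s) + inner (W n) n" if "y \<in> S" for y
    using W_norm_diff_orthogonal[OF assms(1,4), of "y - s"] that assms(2,3)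
    by (simp add: complex_vector.subspace_diff diff_diff_eq)
  have W_norm_nonneg: "0 \<le> W_norm W x" for x
    by (simp add: W_norm_def)
  have le_iff: "W_norm W (z - (s + n)) \<le> W_norm W (y - (s + n)) \<longleftrightarrow>
      inner (W (z - s)) (z - s) \<le> inner (W (y - s)) (y - s)" if "z \<in> S" "y \<in> S" for z y
    using dist[OF that(1)] dist[OF that(2)]
    by (simp add: W_norm_nonneg flip: power_mono_iff[of _ _ 2])
  have "(\<forall>y\<in>S. inner (W (z - s)) (z - s) \<le> inner (W (y - s)) (y - s)) \<longleftrightarrow>
      inner (W (z - s)) (z - s) = 0"
    using assms(3) positive_op_nonneg[OF assms(1)] by (force intro: antisym)
  also have "\<dots> \<longleftrightarrow> W z = W s"
    unfolding positive_op_eq_0_iff[OF assms(1)] by (simp add: clinear_diff[OF W_linear])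
  finally show ?thesis
    unfolding is_arg_min_linorder using le_iff by auto
qed

theorem proposition5p5:
  fixes W :: "'a::complex_hilbert_space \<Rightarrow> 'a"
    and A :: "('a \<times> 'a) set"
    and b x\<^sub>0 :: 'a
  assumes "separable_space (euclidean :: 'a topology)"
    and "positive_op W"
    and "linear_relation A"
    and "b \<in> Domain (W_projection W (Range A))"
    and "W_least_squares_solution W A b x\<^sub>0"
  shows "{x. W_least_squares_solution W A b x} = (+) x\<^sub>0 ` (A\<inverse> `` mul (W_projection W (Range A))) \<and>
         (+) x\<^sub>0 ` (A\<inverse> `` mul (W_projection W (Range A))) = (+) x\<^sub>0 ` (A\<inverse> `` ker_op W)"
proof
  note W_linear = positive_op_linear(1)[OF assms(2)]
  have A_diff: "(x - x', y - y') \<in> A" if "(x, y) \<in> A" "(x', y') \<in> A" for x x' y y'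
    using complex_vector.subspace_diff[OF _ that] assms(3) by (simp add: linear_relation_def)
  have A_add: "(x + x', y + y') \<in> A" if "(x, y) \<in> A" "(x', y') \<in> A" for x x' y y'
    using complex_vector.subspace_add[OF _ that] assms(3) by (simp add: linear_relation_def)
  have A_zero: "(0, 0) \<in> A"
    using complex_vector.subspace_0 assms(3) by (force simp: linear_relation_def zero_prod_def)
  have A_scale: "(c *\<^sub>C x, c *\<^sub>C y) \<in> A" if "(x, y) \<in> A" for c x y
    using complex_vector.subspace_scale[OF _ that] assms(3)
    by (simp add: linear_relation_def scaleC_prod_def)
  have S: "complex_vector.subspace (Range A)"
    unfolding complex_vector.subspace_def using A_zero A_add A_scale by blast
  obtain s n where b: "b = s + n" "s \<in> Range A" "n \<in> W_orthogonal W (Range A)"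
    using assms(4) by (auto simp: W_projection_def)
  \<comment> \<open>Minimisation becomes a linear condition, so solutions can be compared by
    subtraction.\<close>
  have sol_iff: "W_least_squares_solution W A b x \<longleftrightarrow> (\<exists>z. (x, z) \<in> A \<and> W z = W s)" for x
    unfolding W_least_squares_solution_def b(1) W_distance_minimal_iff[OF assms(2) S b(2,3)]
    by blast
  obtain z\<^sub>0 where z\<^sub>0: "(x\<^sub>0, z\<^sub>0) \<in> A" "W z\<^sub>0 = W s"
    using assms(5) sol_iff by blast
  \<comment> \<open>The two sets differ only by intersection with the range of \<open>A\<close>,
    invisible to preimages under \<open>A\<close>.\<close>
  have image_eq: "A\<inverse> `` mul (W_projection W (Range A)) = A\<inverse> `` ker_op W"
    unfolding mul_W_projection[OF assms(2) S] by blast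
  have "W_least_squares_solution W A b x \<longleftrightarrow> x - x\<^sub>0 \<in> A\<inverse> `` ker_op W" for x
  proof
    assume "W_least_squares_solution W A b x"
    then obtain z where "(x, z) \<in> A" "W z = W s"
      using sol_iff by blast
    then have "(x - x\<^sub>0, z - z\<^sub>0) \<in> A" "z - z\<^sub>0 \<in> ker_op W"
      using z\<^sub>0 A_diff by (simp_all add: ker_op_def clinear_diff[OF W_linear])
    then show "x - x\<^sub>0 \<in> A\<inverse> `` ker_op W"
      by blast
  next
    assume "x - x\<^sub>0 \<in> A\<inverse> `` ker_op W"
    then obtain y where y: "(x - x\<^sub>0, y) \<in> A" "W y = 0"
      by (auto simp: ker_op_def)
    have "(x, z\<^sub>0 + y) \<in> A"
      using A_add[OF z\<^sub>0(1) y(1)] by simp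
    moreover have "W (z\<^sub>0 + y) = W s"
      using W_linear y(2) z\<^sub>0(2) by (simp add: clinear_iff)
    ultimately show "W_least_squares_solution W A b x"
      using sol_iff by blast
  qed
  then show "{x. W_least_squares_solution W A b x} =
      (+) x\<^sub>0 ` (A\<inverse> `` mul (W_projection W (Range A)))"
    unfolding image_eq by (force simp: image_iff)
  show "(+) x\<^sub>0 ` (A\<inverse> `` mul (W_projection W (Range A))) = (+) x\<^sub>0 ` (A\<inverse> `` ker_op W)"
    unfolding image_eq ..
qed

end
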